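(* Let $\mathcal{Z}\subset\mathbb{R}^d$ be nonempty, closed and convex, and let $F:\mathcal{Z}\to\mathbb{R}^d$ be a monotone operator that is locally Lipschitz continuous on $\mathcal{Z}$. Assume the variational inequality $\langle F(z_* ),z-z_*\rangle\ge 0$ for all $z\in\mathcal{Z}$ has a solution $z_*\in\mathcal{Z}$. Let $z_0\in\mathcal{Z}$, $\eta_0>0$, $\theta\in(0,1)$, $\rho\in(0,1)$, and run the PF-NE-EG algorithm with standard backtracking line search described in the context. Then at each iteration the backtracking procedure stops after finitely many steps with $\eta_t>0$ (until termination of the algorithm), and, if the algorithm never stops, the extragradient residual satisfies $$\|F(z_T)+\xi_T\|_2=o(1/\sqrt{T})\quad\text{as }T\to\infty .$$
   Context: $F$ is monotone if $\langle F(z)-F(w),z-w\rangle\ge0$ for all $z,w\in\mathcal{Z}$. $F$ is locally Lipschitz on $\mathcal{Z}$ if for every $z\in\mathcal{Z}$ there are $L(z)>0$ and a (relative) neighborhood $N(z)\subset\mathcal{Z}$ of $z$ with $\|F(z')-F(z'')\|_2\le L(z)\|z'-z''\|_2$ for all $z',z''\in N(z)$. $\mathrm{Proj}_{\mathcal{Z}}$ is the Euclidean projection onto $\mathcal{Z}$. Extragradient update with stepsize $\eta_t>0$: $w_t=\mathrm{Proj}_{\mathcal{Z}}(z_t-\eta_tF(z_t))$, $z_{t+1}=\mathrm{Proj}_{\mathcal{Z}}(z_t-\eta_tF(w_t))$. PF-NE-EG algorithm with standard backtracking line search: compute $w_0,z_1$ by the extragradient update from $z_0$ with stepsize $\eta_0$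 (stop and return $z_0$ if $w_0=z_0$). For $t=1,2,\dots$: (1) For $\eta>0$ let $w_t(\eta)=\mathrm{Proj}_{\mathcal{Z}}(z_t-\eta F(z_t))$ and $z_{t+1}(\eta)=\mathrm{Proj}_{\mathcal{Z}}(z_t-\eta F(w_t(\eta)))$. Starting with $\eta=\eta_{t-1}$, repeatedly replace $\eta$ by $\rho\eta$ until both $\eta\,\|F(w_t(\eta))-F(z_t)\|_2/\|w_t(\eta)-z_t\|_2\le\theta$ and, if $w_t(\eta)\ne z_{t+1}(\eta)$, $\eta\,\|F(w_t(\eta))-F(z_{t+1}(\eta))\|_2/\|w_t(\eta)-z_{t+1}(\eta)\|_2\le1$ hold; if $w_t(\eta)=z_t$ is encountered, stop and return $z_t$ (which is then a solution). Set $\eta_t=\eta$. (2) Compute $w_t,z_{t+1}$ by the extragradient update with stepsize $\eta_t$. For $t\ge0$, $\xi_{t+1}=-\frac1{\eta_t}\left[z_{t+1}-(z_t-\eta_tF(w_t))\right]$; the extragradient residual at $z_{t+1}$ is $\|F(z_{t+1})+\xi_{t+1}\|_2$. *)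

theory Defs
  imports "HOL-Analysis.Analysis" "HOL-Library.Landau_Symbols"
begin

text \<open>Operators on \<open>Z\<close> are total functions; only their values on \<open>Z\<close> matter, since the
  algorithm evaluates \<open>F\<close> at \<open>z0\<close> and at projections onto \<open>Z\<close> only.\<close>

definition monotone_operator_on :: "(real ^ 'n) set \<Rightarrow> (real ^ 'n \<Rightarrow> real ^ 'n) \<Rightarrow> bool" where
  "monotone_operator_on Z F \<longleftrightarrow> (\<forall>z\<in>Z. \<forall>w\<in>Z. (F z - F w) \<bullet> (z - w) \<ge> 0)"

definition locally_lipschitz_on :: "(real ^ 'n) set \<Rightarrow> (real ^ 'n \<Rightarrow> real ^ 'n) \<Rightarrow> bool" where
  "locally_lipschitz_on Z F \<longleftrightarrow>
     (\<forall>z\<in>Z. \<exists>L>0. \<exists>N. openin (top_of_set Z) N \<and> z \<in> N \<and>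
        (\<forall>z'\<in>N. \<forall>z''\<in>N. norm (F z' - F z'') \<le> L * norm (z' - z'')))"

definition vi_solution :: "(real ^ 'n) set \<Rightarrow> (real ^ 'n \<Rightarrow> real ^ 'n) \<Rightarrow> real ^ 'n \<Rightarrow> bool" where
  "vi_solution Z F zs \<longleftrightarrow> zs \<in> Z \<and> (\<forall>z\<in>Z. F zs \<bullet> (z - zs) \<ge> 0)"

definition eg_mid :: "(real ^ 'n) set \<Rightarrow> (real ^ 'n \<Rightarrow> real ^ 'n) \<Rightarrow> real ^ 'n \<Rightarrow> real \<Rightarrow> real ^ 'n" where
  "eg_mid Z F z \<eta> = closest_point Z (z - \<eta> *\<^sub>R F z)"

definition eg_next :: "(real ^ 'n) set \<Rightarrow> (real ^ 'n \<Rightarrow> real ^ 'n) \<Rightarrow> real ^ 'n \<Rightarrow> real \<Rightarrow> real ^ 'n" where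
  "eg_next Z F z \<eta> = closest_point Z (z - \<eta> *\<^sub>R F (eg_mid Z F z \<eta>))"

definition step_ok ::
  "(real ^ 'n) set \<Rightarrow> (real ^ 'n \<Rightarrow> real ^ 'n) \<Rightarrow> real \<Rightarrow> real ^ 'n \<Rightarrow> real \<Rightarrow> bool" where
  "step_ok Z F \<theta> z \<eta> \<longleftrightarrow>
     (let w = eg_mid Z F z \<eta>; z' = eg_next Z F z \<eta> in
        \<eta> * norm (F w - F z) / norm (w - z) \<le> \<theta> \<and>
        (w \<noteq> z' \<longrightarrow> \<eta> * norm (F w - F z') / norm (w - z') \<le> 1))"

datatype ls_result = Stop | Accept real

text \<open>\<open>line_search Z F \<theta> \<rho> z \<eta> r\<close>: backtracking at the iterate \<open>z\<close>, started with trial stepsize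
  \<open>\<eta>\<close>, finishes with result \<open>r\<close>. As the predicate is inductive, this asserts that
  only finitely many trials are made. \<open>Stop\<close> means that the whole algorithm stops and returns \<open>z\<close>.\<close>

inductive line_search ::
  "(real ^ 'n) set \<Rightarrow> (real ^ 'n \<Rightarrow> real ^ 'n) \<Rightarrow> real \<Rightarrow> real \<Rightarrow> real ^ 'n \<Rightarrow> real \<Rightarrow> ls_result \<Rightarrow> bool"
  for Z F \<theta> \<rho> z where
  stop: "eg_mid Z F z \<eta> = z \<Longrightarrow> line_search Z F \<theta> \<rho> z \<eta> Stop"
| accept: "eg_mid Z F z \<eta> \<noteq> z \<Longrightarrow> step_ok Z F \<theta> z \<eta> \<Longrightarrow>
    line_search Z F \<theta> \<rho> z \<eta> (Accept \<eta>)"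
| shrink: "eg_mid Z F z \<eta> \<noteq> z \<Longrightarrow> \<not> step_ok Z F \<theta> z \<eta> \<Longrightarrow>
    line_search Z F \<theta> \<rho> z (\<rho> * \<eta>) r \<Longrightarrow> line_search Z F \<theta> \<rho> z \<eta> r"

text \<open>The algorithm completes iterations \<open>0, \<dots>, T\<close> without stopping, producing
  \<open>w t\<close>, \<open>\<eta> t\<close> for \<open>t \<le> T\<close> and \<open>z t\<close> for \<open>t \<le> T + 1\<close>; later entries of the sequences are
  unconstrained.\<close>

definition pf_ne_eg_upto ::
  "(real ^ 'n) set \<Rightarrow> (real ^ 'n \<Rightarrow> real ^ 'n) \<Rightarrow> real \<Rightarrow> real \<Rightarrow> real ^ 'n \<Rightarrow> real \<Rightarrow>
   nat \<Rightarrow> (nat \<Rightarrow> real ^ 'n) \<Rightarrow> (nat \<Rightarrow> real ^ 'n) \<Rightarrow> (nat \<Rightarrow> real) \<Rightarrow> bool" where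
  "pf_ne_eg_upto Z F \<theta> \<rho> z0 \<eta>0 T z w \<eta> \<longleftrightarrow>
     z 0 = z0 \<and> \<eta> 0 = \<eta>0 \<and> w 0 \<noteq> z 0 \<and>
     (\<forall>t<T. line_search Z F \<theta> \<rho> (z (Suc t)) (\<eta> t) (Accept (\<eta> (Suc t)))) \<and>
     (\<forall>t\<le>T. w t = eg_mid Z F (z t) (\<eta> t) \<and> z (Suc t) = eg_next Z F (z t) (\<eta> t))"

definition pf_ne_eg_forever ::
  "(real ^ 'n) set \<Rightarrow> (real ^ 'n \<Rightarrow> real ^ 'n) \<Rightarrow> real \<Rightarrow> real \<Rightarrow> real ^ 'n \<Rightarrow> real \<Rightarrow>
   (nat \<Rightarrow> real ^ 'n) \<Rightarrow> (nat \<Rightarrow> real ^ 'n) \<Rightarrow> (nat \<Rightarrow> real) \<Rightarrow> bool" where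
  "pf_ne_eg_forever Z F \<theta> \<rho> z0 \<eta>0 z w \<eta> \<longleftrightarrow> (\<forall>T. pf_ne_eg_upto Z F \<theta> \<rho> z0 \<eta>0 T z w \<eta>)"

end

theory Submission
  imports Defs
begin

text \<open>Two energies drive the proof. From \<open>t = 1\<close> on, \<open>dist (z t) z\<^sub>*\<close> decreases, and the drop of its square
  dominates \<open>\<parallel>z t - w t\<parallel>\<^sup>2 + \<parallel>w t - z (t+1)\<parallel>\<^sup>2\<close>, which is therefore summable. All trial points then lie
  in one compact set, where \<open>F\<close> is Lipschitz, so backtracking never pushes the stepsize below a
  positive constant and the squared residual at \<open>z (t+1)\<close> is at most a multiple of the drop.
  Second, the residual itself is nonincreasing: \<open>\<xi> t\<close> lies in the normal cone at \<open>z t\<close>, and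
  the difference of consecutive squared residuals is an explicit sum of nonnegative terms.
  A nonincreasing summable sequence is \<open>o(1/T)\<close>.\<close>

section \<open>Rates for nonincreasing summable sequences\<close>

text \<open>For \<open>n \<ge> 2 * N\<close> at least half of the first \<open>n\<close> indices lie
  in \<open>{N..<n}\<close>, and each of these terms is at least \<open>a n\<close>. So
  \<open>n * a n\<close> is at most twice a Cauchy block of the series.\<close>

lemma decseq_summable_tendsto_0:
  fixes a :: "nat \<Rightarrow> real"
  assumes "decseq a" "summable a" "\<And>n. 0 \<le> a n"
  shows "(\<lambda>n. real n * a n) \<longlonglongrightarrow> 0"
proof (rule LIMSEQ_I)
  fix e :: real assume "0 < e"
  then obtain N where N: "\<And>m n. m \<ge> N \<Longrightarrow> norm (sum a {m..<n}) < e / 2"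
    using assms(2) unfolding summable_Cauchy by (meson half_gt_zero)
  have "norm (real n * a n - 0) < e" if "n \<ge> 2 * N" for n
  proof -
    have "real n * a n \<le> 2 * (real (n - N) * a n)"
      using that assms(3)[of n] mult_right_mono[of "real n" "2 * real (n - N)" "a n"]
      by (simp add: mult.assoc[symmetric])
    also have "real (n - N) * a n = (\<Sum>k\<in>{N..<n}. a n)" by simp
    also have "\<dots> \<le> sum a {N..<n}"
      using assms(1) by (intro sum_mono) (auto simp: decseq_def)
    also have "\<dots> < e / 2" using N[of N n] by simp
    finally show ?thesis using assms(3)[of n] by simp
  qed
  then show "\<exists>no. \<forall>n\<ge>no. norm (real n * a n - 0) < e" by blast
qed

text \<open>The preceding limit for the squares, followed by a square root. Monotonicity and
  summability start at index 1 because \<open>\<xi> 0\<close>, and with it the residual at index 0,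
  is arbitrary.\<close>

lemma smallo_inverse_sqrt:
  fixes r :: "nat \<Rightarrow> real"
  assumes "\<And>n. r (Suc (Suc n)) \<le> r (Suc n)" "summable (\<lambda>n. (r (Suc n))\<^sup>2)" "\<And>n. 0 \<le> r n"
  shows "r \<in> o(\<lambda>n. 1 / sqrt (real n))"
proof -
  let ?a = "\<lambda>n. (r (Suc n))\<^sup>2"
  have "decseq ?a"
    using assms(1,3) by (intro decseq_SucI power_mono) auto
  then have "(\<lambda>n. real n * ?a n) \<longlonglongrightarrow> 0"
    using assms(2) by (intro decseq_summable_tendsto_0) auto
  \<comment> \<open>Adding the null sequence \<open>?a\<close> turns the factor \<open>n\<close>
    into \<open>Suc n\<close>, which matches the index of \<open>r (Suc n)\<close>.\<close>
  then have "(\<lambda>n. real n * ?a n + ?a n) \<longlonglongrightarrow> 0 + 0"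
    by (rule tendsto_add[OF _ summable_LIMSEQ_zero[OF assms(2)]])
  then have "(\<lambda>n. sqrt (real (Suc n) * ?a n)) \<longlonglongrightarrow> sqrt 0"
    by (intro tendsto_real_sqrt) (simp add: algebra_simps)
  then have "(\<lambda>n. r (Suc n) * sqrt (real (Suc n))) \<longlonglongrightarrow> 0"
    using assms(3) by (simp add: real_sqrt_mult mult.commute)
  then have "(\<lambda>n. r n / (1 / sqrt (real n))) \<longlonglongrightarrow> 0"
    by (subst filterlim_sequentially_Suc[symmetric]) simp
  then show ?thesis
    by (rule smalloI_tendsto) (auto simp: eventually_sequentially intro!: exI[of _ 1])
qed

section \<open>Geometry of a single extragradient step\<close>

text \<open>Meant for \<open>A\<close>, \<open>B\<close>, \<open>C\<close> the values of
  \<open>F\<close> at \<open>z\<close>, \<open>w\<close>, \<open>z'\<close> and \<open>a\<close>,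
  \<open>b\<close>, \<open>c\<close> normal vectors there. Then \<open>A + b\<close>,
  \<open>B + c\<close> and \<open>B - A + c - b\<close> are \<open>z - w\<close>,
  \<open>z - z'\<close> and \<open>w - z'\<close> divided by the stepsize, so every summand on the
  right acquires a sign.\<close>

lemma residual_identity:
  fixes A B C a b c :: "'a::real_inner"
  shows "(norm (A + a))\<^sup>2 - (norm (C + c))\<^sup>2 =
    ((norm (B - A + c - b))\<^sup>2 - (norm (B - C))\<^sup>2) + 2 * ((A - C) \<bullet> (B + c)) - 2 * (c \<bullet> (B + c))
    + 2 * (b \<bullet> (B - A + c - b)) + 2 * (a \<bullet> (A + b)) + (norm (a - b))\<^sup>2"
  by (simp add: power2_norm_eq_inner algebra_simps inner_commute)

lemma closest_point_normal:
  assumes "convex Z" "closed Z" "u \<in> Z" "closest_point Z x = p"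
  shows "(x - p) \<bullet> (u - p) \<le> 0"
  using closest_point_dot[OF assms(1-3), of x] assms(4) by simp

lemma eg_in_set:
  assumes "closed Z" "z \<in> Z"
  shows "eg_mid Z F z \<eta> \<in> Z" "eg_next Z F z \<eta> \<in> Z"
  using assms closest_point_in_set unfolding eg_mid_def eg_next_def by blast+

text \<open>The projection is nonexpansive and fixes \<open>z\<close>.\<close>

lemma closest_point_step_le:
  assumes "convex Z" "closed Z" "z \<in> Z" "0 \<le> \<eta>"
  shows "norm (closest_point Z (z - \<eta> *\<^sub>R v) - z) \<le> \<eta> * norm v"
proof -
  have "Z \<noteq> {}" using assms(3) by auto
  from closest_point_lipschitz[OF assms(1,2) this, of "z - \<eta> *\<^sub>R v" z]
  show ?thesis using assms by (simp add: closest_point_self dist_norm)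
qed

text \<open>Every summand in \<open>residual_identity\<close> is nonnegative: by the second line
  search test, by monotonicity between \<open>z\<close> and \<open>z'\<close>, by the obtuse angle
  property of the projections giving \<open>z'\<close> and \<open>w\<close>, and by normality of
  \<open>x\<close> at \<open>z\<close>. The vector \<open>x'\<close> is normal at \<open>z'\<close>,
  so the argument can be iterated.\<close>

lemma residual_nonincreasing:
  fixes F :: "real ^ 'n \<Rightarrow> real ^ 'n"
  assumes Z: "closed Z" "convex Z" and mon: "monotone_operator_on Z F"
    and z: "z \<in> Z" and \<eta>: "0 < \<eta>"
    and w: "w = eg_mid Z F z \<eta>" and z': "z' = eg_next Z F z \<eta>"
    and lip: "\<eta> * norm (F w - F z') \<le> norm (w - z')"
    and normal: "\<And>u. u \<in> Z \<Longrightarrow> x \<bullet> (u - z) \<le> 0"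
    and x': "x' = - (1 / \<eta>) *\<^sub>R (z' - (z - \<eta> *\<^sub>R F w))"
  shows "norm (F z' + x') \<le> norm (F z + x)"
proof -
  \<comment> \<open>The displacement of the projection onto \<open>w\<close>, divided by the
    stepsize: a normal vector at \<open>w\<close>, as \<open>x'\<close> is at
    \<open>z'\<close>.\<close>
  define b where "b = (1 / \<eta>) *\<^sub>R (z - \<eta> *\<^sub>R F z - w)"
  have wZ: "w \<in> Z" and z'Z: "z' \<in> Z"
    using eg_in_set[OF Z(1) z] w z' by auto
  have Bc: "z - z' = \<eta> *\<^sub>R (F w + x')"
    using \<eta> by (simp add: x' algebra_simps)
  have Ab: "z - w = \<eta> *\<^sub>R (F z + b)"
    using \<eta> by (simp add: b_def algebra_simps)
  have wz': "w - z' = \<eta> *\<^sub>R (F w - F z + x' - b)"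
  proof -
    have "w - z' = (z - z') - (z - w)" by simp
    then show ?thesis unfolding Bc Ab by (simp add: algebra_simps)
  qed
  have eqb: "z - \<eta> *\<^sub>R F z - w = \<eta> *\<^sub>R b" using \<eta> by (simp add: b_def)
  have eqc: "z - \<eta> *\<^sub>R F w - z' = \<eta> *\<^sub>R x'" using \<eta> by (simp add: x' algebra_simps)
  have 1: "(F z - F z') \<bullet> (F w + x') \<ge> 0"
  proof -
    have "(F z - F z') \<bullet> (z - z') \<ge> 0"
      using mon z z'Z unfolding monotone_operator_on_def by blast
    then show ?thesis using \<eta> unfolding Bc by (simp add: zero_le_mult_iff)
  qed
  have 2: "x' \<bullet> (F w + x') \<le> 0"
  proof -
    have "(\<eta> *\<^sub>R x') \<bullet> (z - z') \<le> 0"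
      using closest_point_normal[OF Z(2,1) z, of "z - \<eta> *\<^sub>R F w" z'] z' w eqc
      by (simp add: eg_next_def)
    then show ?thesis using \<eta> unfolding Bc by (simp add: mult_le_0_iff)
  qed
  have 3: "b \<bullet> (F w - F z + x' - b) \<ge> 0"
  proof -
    have "(\<eta> *\<^sub>R b) \<bullet> (z' - w) \<le> 0"
      using closest_point_normal[OF Z(2,1) z'Z, of "z - \<eta> *\<^sub>R F z" w] w eqb
      by (simp add: eg_mid_def)
    then have "(\<eta> *\<^sub>R b) \<bullet> (w - z') \<ge> 0" by (simp add: inner_diff_right)
    then show ?thesis using \<eta> unfolding wz' by (simp add: zero_le_mult_iff)
  qed
  have 4: "x \<bullet> (F z + b) \<ge> 0"
  proof -
    have "x \<bullet> (z - w) \<ge> 0" using normal[OF wZ] by (simp add: inner_diff_right)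
    then show ?thesis using \<eta> unfolding Ab by (simp add: zero_le_mult_iff)
  qed
  have "norm (F w - F z') \<le> norm (F w - F z + x' - b)"
    using lip \<eta> unfolding wz' by simp
  then have 5: "(norm (F w - F z'))\<^sup>2 \<le> (norm (F w - F z + x' - b))\<^sup>2"
    by (simp add: power_mono)
  have "(norm (F z' + x'))\<^sup>2 \<le> (norm (F z + x))\<^sup>2"
    using residual_identity[of "F z" x "F z'" x' "F w" b] 1 2 3 4 5
      zero_le_power2[of "norm (x - b)"] by linarith
  then show ?thesis by (rule power2_le_imp_le) simp
qed

text \<open>The classical extragradient estimate. In the expansion \<open>id\<close>, three inner
  products have a sign: one because \<open>u\<close> is a solution and \<open>F\<close> is monotone,
  two by the projections, tested at \<open>u\<close> and at \<open>z'\<close>. The cross term left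
  over is absorbed up to the factor \<open>\<theta>\<close> by the first line search test and
  \<open>2pq \<le> p^2 + q^2\<close>.\<close>

lemma eg_descent:
  fixes F :: "real ^ 'n \<Rightarrow> real ^ 'n"
  assumes Z: "closed Z" "convex Z" and mon: "monotone_operator_on Z F"
    and z: "z \<in> Z" and \<eta>: "0 < \<eta>" and u: "vi_solution Z F u"
    and w: "w = eg_mid Z F z \<eta>" and z': "z' = eg_next Z F z \<eta>"
    and lip: "\<eta> * norm (F w - F z) \<le> \<theta> * norm (w - z)" and "0 \<le> \<theta>"
  shows "(1 - \<theta>) * ((norm (z - w))\<^sup>2 + (norm (w - z'))\<^sup>2) \<le> (norm (z - u))\<^sup>2 - (norm (z' - u))\<^sup>2"
proof -
  have wZ: "w \<in> Z" and z'Z: "z' \<in> Z"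
    using eg_in_set[OF Z(1) z] w z' by auto
  have uZ: "u \<in> Z" and "F u \<bullet> (w - u) \<ge> 0" using u wZ by (auto simp: vi_solution_def)
  moreover have "(F w - F u) \<bullet> (w - u) \<ge> 0"
    using mon wZ uZ unfolding monotone_operator_on_def by blast
  ultimately have "F w \<bullet> (w - u) \<ge> 0" by (simp add: inner_diff_left)
  then have 1: "\<eta> * (F w \<bullet> (w - u)) \<ge> 0" using \<eta> by simp
  have 2: "(z - \<eta> *\<^sub>R F w - z') \<bullet> (u - z') \<le> 0"
    using closest_point_normal[OF Z(2,1) uZ, of "z - \<eta> *\<^sub>R F w" z'] z' w
    by (simp add: eg_next_def)
  have 3: "(z - \<eta> *\<^sub>R F z - w) \<bullet> (z' - w) \<le> 0"
    using closest_point_normal[OF Z(2,1) z'Z, of "z - \<eta> *\<^sub>R F z" w] w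
    by (simp add: eg_mid_def)
  have id: "(norm (z - u))\<^sup>2 - (norm (z' - u))\<^sup>2 = (norm (z - w))\<^sup>2 + (norm (w - z'))\<^sup>2
      + 2 * (\<eta> * (F w \<bullet> (w - u))) - 2 * ((z - \<eta> *\<^sub>R F w - z') \<bullet> (u - z'))
      - 2 * ((z - \<eta> *\<^sub>R F z - w) \<bullet> (z' - w)) - 2 * ((\<eta> *\<^sub>R (F w - F z)) \<bullet> (w - z'))"
    by (simp add: power2_norm_eq_inner algebra_simps inner_commute)
  have "(\<eta> *\<^sub>R (F w - F z)) \<bullet> (w - z') \<le> norm (\<eta> *\<^sub>R (F w - F z)) * norm (w - z')"
    by (rule norm_cauchy_schwarz)
  also have "\<dots> \<le> (\<theta> * norm (z - w)) * norm (w - z')"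
    using lip \<eta> by (intro mult_right_mono) (auto simp: norm_minus_commute)
  finally have "2 * ((\<eta> *\<^sub>R (F w - F z)) \<bullet> (w - z')) \<le> \<theta> * (2 * norm (z - w) * norm (w - z'))"
    by simp
  also have "\<dots> \<le> \<theta> * ((norm (z - w))\<^sup>2 + (norm (w - z'))\<^sup>2)"
    using \<open>0 \<le> \<theta>\<close> sum_squares_bound by (intro mult_left_mono) auto
  finally show ?thesis using id 1 2 3 by (simp add: algebra_simps)
qed

text \<open>Scaled by \<open>\<eta>\<close>, the residual vector is
  \<open>\<eta> *\<^sub>R (F z' - F w)\<close> plus \<open>z - z'\<close>. The second test bounds
  the former by \<open>norm (w - z')\<close>, and the latter splits at \<open>w\<close>. The factor
  8 comes from \<open>(2 * (p + q))^2 \<le> 8 * (p^2 + q^2)\<close>.\<close>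

lemma residual_le:
  fixes F :: "real ^ 'n \<Rightarrow> real ^ 'n"
  assumes "0 < \<eta>" and lip: "\<eta> * norm (F w - F z') \<le> norm (w - z')"
    and x': "x' = - (1 / \<eta>) *\<^sub>R (z' - (z - \<eta> *\<^sub>R F w))"
  shows "(norm (F z' + x'))\<^sup>2 \<le> 8 / \<eta>\<^sup>2 * ((norm (z - w))\<^sup>2 + (norm (w - z'))\<^sup>2)"
proof -
  let ?p = "norm (z - w)" and ?q = "norm (w - z')"
  have "\<eta> *\<^sub>R (F z' + x') = \<eta> *\<^sub>R (F z' - F w) + ((z - w) + (w - z'))"
    using assms(1) by (simp add: x' algebra_simps)
  then have "\<eta> * norm (F z' + x') = norm (\<eta> *\<^sub>R (F z' - F w) + ((z - w) + (w - z')))"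
    using assms(1) by (metis abs_of_pos norm_scaleR)
  also have "\<dots> \<le> norm (\<eta> *\<^sub>R (F z' - F w)) + (?p + ?q)"
    by (intro norm_triangle_mono order_refl norm_triangle_ineq)
  \<comment> \<open>The sum is really at most \<open>?p + 2 * ?q\<close>; nonnegativity of
    \<open>?p\<close> rounds this up to a symmetric bound.\<close>
  also have "\<dots> \<le> 2 * (?p + ?q)"
    using lip assms(1) norm_ge_zero[of "z - w"]
    by (simp add: norm_minus_commute[of "F z'"] del: norm_ge_zero)
  finally have "(\<eta> * norm (F z' + x'))\<^sup>2 \<le> (2 * (?p + ?q))\<^sup>2"
    using assms(1) by (intro power_mono) auto
  also have "\<dots> \<le> 8 * (?p\<^sup>2 + ?q\<^sup>2)"
    using sum_squares_bound[of ?p ?q] by (simp add: power2_sum power_mult_distrib)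
  finally show ?thesis using assms(1) by (simp add: field_simps)
qed

section \<open>From local Lipschitz continuity to bounds on compact sets\<close>

lemma locally_lipschitz_on_compact:
  assumes "locally_lipschitz_on Z F" "K \<subseteq> Z" "compact K"
  obtains L where "0 < L" "L-lipschitz_on K F"
proof -
  \<comment> \<open>\<open>F\<close> is read as a time-dependent field on the single time 0, which
    gives access to the compactness theorem for \<open>local_lipschitz\<close>.\<close>
  have "local_lipschitz {0::real} Z (\<lambda>_. F)"
  proof (rule local_lipschitzI)
    fix t :: real and x assume "x \<in> Z"
    then obtain L N where "L > 0" "openin (top_of_set Z) N" "x \<in> N"
      and L: "\<forall>z'\<in>N. \<forall>z''\<in>N. norm (F z' - F z'') \<le> L * norm (z' - z'')"
      using assms(1) unfolding locally_lipschitz_on_def by meson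
    then obtain e where "e > 0" "cball x e \<inter> Z \<subseteq> N"
      unfolding openin_contains_cball by blast
    then have "L-lipschitz_on (cball x e \<inter> Z) F"
      unfolding lipschitz_on_def dist_norm using L \<open>L > 0\<close> by (meson less_imp_le subsetD)
    with \<open>e > 0\<close> show "\<exists>u>0. \<exists>L. \<forall>t\<in>cball t u \<inter> {0}. L-lipschitz_on (cball x u \<inter> Z) F"
      by blast
  qed
  then have "local_lipschitz {0::real} K (\<lambda>_. F)"
    by (rule local_lipschitz_subset) (use assms in auto)
  from local_lipschitz_compact_implies_lipschitz[OF this assms(3) compact_sing continuous_on_const]
  obtain L where L: "L-lipschitz_on K F" by (metis insertI1)
  \<comment> \<open>The constant is enlarged to be strictly positive, since
    \<open>\<theta> / L\<close> is formed later.\<close>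
  have "\<bar>L\<bar> + 1 > 0" "(\<bar>L\<bar> + 1)-lipschitz_on K F"
    using L by (auto intro: lipschitz_on_le)
  then show ?thesis using that by blast
qed

lemma locally_lipschitz_on_bounded:
  fixes F :: "real ^ 'n \<Rightarrow> real ^ 'n"
  assumes "locally_lipschitz_on Z F" "closed Z"
  obtains M where "0 \<le> M" "\<And>z. z \<in> Z \<Longrightarrow> norm z \<le> R \<Longrightarrow> norm (F z) \<le> M"
proof -
  let ?K = "Z \<inter> cball 0 R"
  have K: "compact ?K" using assms(2) by (simp add: closed_Int_compact)
  obtain L where "L-lipschitz_on ?K F"
    using locally_lipschitz_on_compact[OF assms(1) _ K] by blast
  then have "compact (F ` ?K)"
    using K lipschitz_on_continuous_on compact_continuous_image by blast
  then obtain M where "\<forall>y\<in>F ` ?K. norm y \<le> M"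
    using compact_imp_bounded bounded_iff by blast
  then have "norm (F z) \<le> max M 0" if "z \<in> Z" "norm z \<le> R" for z
    using that by (intro max.coboundedI1) simp
  then show ?thesis using that[of "max M 0"] by simp
qed

text \<open>From a start of norm at most \<open>R\<close> with stepsize at most \<open>s\<close>,
  all trial points stay in one compact \<open>K\<close>. With a Lipschitz constant \<open>L\<close>
  of \<open>F\<close> on \<open>K\<close>, any stepsize up to \<open>\<theta> / L\<close> makes both
  test quotients at most \<open>\<theta> < 1\<close>. Uniformity in \<open>z\<close> is what later
  bounds the stepsizes from below.\<close>

lemma step_ok_uniform:
  fixes F :: "real ^ 'n \<Rightarrow> real ^ 'n"
  assumes Z: "closed Z" "convex Z" and F: "locally_lipschitz_on Z F"
    and "0 < \<theta>" "\<theta> < 1"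
  obtains c where "0 < c"
    "\<And>z \<eta>. z \<in> Z \<Longrightarrow> norm z \<le> R \<Longrightarrow> 0 < \<eta> \<Longrightarrow> \<eta> \<le> s \<Longrightarrow> \<eta> \<le> c \<Longrightarrow> step_ok Z F \<theta> z \<eta>"
proof -
  obtain M1 where M1: "0 \<le> M1" "\<And>z. z \<in> Z \<Longrightarrow> norm z \<le> R \<Longrightarrow> norm (F z) \<le> M1"
    using locally_lipschitz_on_bounded[OF F Z(1)] by blast
  \<comment> \<open>Two stages are needed: \<open>M1\<close> controls how far \<open>w\<close>
    moves, and only then can \<open>F w\<close>, and so the move to \<open>z'\<close>, be bounded by
    \<open>M2\<close>.\<close>
  define R1 where "R1 = R + s * M1"
  obtain M2 where M2: "0 \<le> M2" "\<And>z. z \<in> Z \<Longrightarrow> norm z \<le> R1 \<Longrightarrow> norm (F z) \<le> M2"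
    using locally_lipschitz_on_bounded[OF F Z(1)] by blast
  define K where "K = Z \<inter> cball 0 (max R1 (R + s * M2))"
  have "K \<subseteq> Z" "compact K" using Z(1) by (auto simp: K_def closed_Int_compact)
  then obtain L where L: "0 < L" "L-lipschitz_on K F"
    by (rule locally_lipschitz_on_compact[OF F])
  have "step_ok Z F \<theta> z \<eta>"
    if z: "z \<in> Z" "norm z \<le> R" and \<eta>: "0 < \<eta>" "\<eta> \<le> s" "\<eta> \<le> \<theta> / L" for z \<eta>
  proof -
    define w z' where "w = eg_mid Z F z \<eta>" and "z' = eg_next Z F z \<eta>"
    have wZ: "w \<in> Z" "z' \<in> Z" using eg_in_set[OF Z(1) z(1)] by (auto simp: w_def z'_def)
    have "norm (w - z) \<le> \<eta> * norm (F z)"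
      using closest_point_step_le[OF Z(2,1) z(1)] \<eta>(1) by (simp add: w_def eg_mid_def)
    also have "\<dots> \<le> s * M1"
      using \<eta> M1(1) M1(2)[OF z] by (intro mult_mono) auto
    finally have "norm w \<le> R1"
      using z(2) norm_triangle_sub[of w z] by (simp add: R1_def)
    have "norm (z' - z) \<le> \<eta> * norm (F w)"
      using closest_point_step_le[OF Z(2,1) z(1)] \<eta>(1) by (simp add: z'_def w_def eg_next_def)
    also have "\<dots> \<le> s * M2"
      using \<eta> M2(1) M2(2)[OF wZ(1) \<open>norm w \<le> R1\<close>] by (intro mult_mono) auto
    finally have "norm z' \<le> R + s * M2"
      using z(2) norm_triangle_sub[of z' z] by simp
    moreover have "R \<le> R1" using \<eta> M1(1) by (simp add: R1_def)
    ultimately have K: "z \<in> K" "w \<in> K" "z' \<in> K"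
      using z wZ \<open>norm w \<le> R1\<close> by (auto simp: K_def)
    have quot: "\<eta> * norm (F p - F q) / norm (p - q) \<le> \<theta>" if "p \<in> K" "q \<in> K" for p q
    proof -
      have "\<eta> * norm (F p - F q) \<le> \<theta> / L * (L * norm (p - q))"
        using lipschitz_onD[OF L(2) that] \<eta> L(1) \<open>0 < \<theta>\<close>
        by (intro mult_mono) (auto simp: dist_norm)
      also have "\<dots> = \<theta> * norm (p - q)" using L(1) by simp
      \<comment> \<open>For \<open>p = q\<close> the quotient is \<open>0 / 0 = 0\<close>.\<close>
      finally show ?thesis
        using \<open>0 < \<theta>\<close> by (cases "p = q") (auto simp: divide_le_eq)
    qed
    have "\<eta> * norm (F w - F z) / norm (w - z) \<le> \<theta>" "\<eta> * norm (F w - F z') / norm (w - z') \<le> 1"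
      using quot[of w z] quot[of w z'] K \<open>\<theta> < 1\<close> by auto
    then show ?thesis unfolding step_ok_def Let_def w_def[symmetric] z'_def[symmetric] by simp
  qed
  moreover have "0 < \<theta> / L" using L(1) \<open>0 < \<theta>\<close> by simp
  ultimately show ?thesis using that by blast
qed

section \<open>Backtracking: termination and size of the accepted step\<close>

text \<open>Induction on a number \<open>n\<close> of reductions that suffices to bring the trial
  stepsize below \<open>c\<close>; by then the search has stopped or accepted.\<close>

lemma line_search_terminates:
  assumes "0 < \<rho>" "\<rho> < 1" "0 < \<eta>" "0 < c"
    and ok: "\<And>s. 0 < s \<Longrightarrow> s \<le> \<eta> \<Longrightarrow> s \<le> c \<Longrightarrow> step_ok Z F \<theta> z s"
  shows "\<exists>r. line_search Z F \<theta> \<rho> z \<eta> r"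
proof -
  obtain n where n: "\<rho> ^ n * \<eta> \<le> c"
  proof -
    obtain n where "\<rho> ^ n < c / \<eta>"
      using real_arch_pow_inv[of "c / \<eta>" \<rho>] assms by auto
    then show ?thesis using that[of n] assms(3) by (simp add: field_simps)
  qed
  show ?thesis using assms(3) n ok
  proof (induction n arbitrary: \<eta>)
    case 0
    then have "step_ok Z F \<theta> z \<eta>" by simp
    then show ?case by (metis line_search.intros(1,2))
  next
    case (Suc n)
    have le: "\<rho> * \<eta> \<le> \<eta>" using assms(1,2) Suc.prems(1) by simp
    have "\<exists>r. line_search Z F \<theta> \<rho> z (\<rho> * \<eta>) r"
    proof (rule Suc.IH)
      show "0 < \<rho> * \<eta>" "\<rho> ^ n * (\<rho> * \<eta>) \<le> c"
        using Suc.prems(1,2) assms(1) by (simp_all add: mult_ac)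
    qed (use le Suc.prems(3) in force)
    then show ?case by (metis line_search.intros)
  qed
qed

lemma line_search_AcceptD:
  assumes "line_search Z F \<theta> \<rho> z \<eta> (Accept \<eta>')" "0 < \<rho>" "\<rho> < 1" "0 < \<eta>"
  shows "0 < \<eta>' \<and> \<eta>' \<le> \<eta> \<and> step_ok Z F \<theta> z \<eta>' \<and> eg_mid Z F z \<eta>' \<noteq> z"
  using assms
proof (induction \<eta> "Accept \<eta>'" rule: line_search.induct)
  case (shrink \<eta>)
  then have "\<rho> * \<eta> \<le> \<eta>" "0 < \<rho> * \<eta>" by auto
  with shrink show ?case by auto
qed auto

text \<open>A rejected trial must exceed \<open>c\<close>, so the one after it exceeds
  \<open>\<rho> * c\<close>. Without any rejection the initial \<open>\<eta>\<close> itself is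
  accepted.\<close>

lemma line_search_Accept_ge:
  assumes "line_search Z F \<theta> \<rho> z \<eta> (Accept \<eta>')" "0 < \<rho>" "\<rho> < 1" "0 < \<eta>" "0 < c"
    and "\<And>s. 0 < s \<Longrightarrow> s \<le> \<eta> \<Longrightarrow> s \<le> c \<Longrightarrow> step_ok Z F \<theta> z s"
  shows "min \<eta> (\<rho> * c) \<le> \<eta>'"
  using assms
proof (induction \<eta> "Accept \<eta>'" rule: line_search.induct)
  case (shrink \<eta>)
  have le: "\<rho> * \<eta> \<le> \<eta>" "0 < \<rho> * \<eta>" using shrink.prems by auto
  have "min (\<rho> * \<eta>) (\<rho> * c) \<le> \<eta>'"
    by (rule shrink.hyps(4)[OF shrink.prems(1,2) le(2) shrink.prems(4)])
      (use le(1) shrink.prems(5) in force)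
  moreover have "c < \<eta>" using shrink.hyps(2) shrink.prems(3,5) by force
  then have "\<rho> * c \<le> \<rho> * \<eta>" using shrink.prems(1) by simp
  ultimately show ?case by linarith
qed auto

text \<open>Clears the denominators of the tests. As \<open>x / 0 = 0\<close>, the first requires
  that \<open>w\<close> differ from \<open>z\<close>; in the second, coinciding points make both
  sides 0.\<close>

lemma step_okD:
  assumes "step_ok Z F \<theta> z \<eta>" "eg_mid Z F z \<eta> \<noteq> z"
  shows "\<eta> * norm (F (eg_mid Z F z \<eta>) - F z) \<le> \<theta> * norm (eg_mid Z F z \<eta> - z)"
    and "\<eta> * norm (F (eg_mid Z F z \<eta>) - F (eg_next Z F z \<eta>))
      \<le> norm (eg_mid Z F z \<eta> - eg_next Z F z \<eta>)"
proof -
  show "\<eta> * norm (F (eg_mid Z F z \<eta>) - F z) \<le> \<theta> * norm (eg_mid Z F z \<eta> - z)"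
    using assms by (simp add: step_ok_def Let_def divide_le_eq)
  show "\<eta> * norm (F (eg_mid Z F z \<eta>) - F (eg_next Z F z \<eta>))
      \<le> norm (eg_mid Z F z \<eta> - eg_next Z F z \<eta>)"
    using assms
    by (cases "eg_mid Z F z \<eta> = eg_next Z F z \<eta>") (auto simp: step_ok_def Let_def divide_le_eq)
qed

section \<open>Runs of the algorithm and the rate\<close>

lemma pf_ne_eg_upto_invariant:
  assumes "pf_ne_eg_upto Z F \<theta> \<rho> z0 \<eta>0 T z w \<eta>"
    and "closed Z" "z0 \<in> Z" "\<eta>0 > 0" "0 < \<rho>" "\<rho> < 1" "t \<le> T"
  shows "z t \<in> Z \<and> z (Suc t) \<in> Z \<and> 0 < \<eta> t \<and> \<eta> t \<le> \<eta>0"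
  using \<open>t \<le> T\<close>
proof (induction t)
  case 0
  then show ?case using assms eg_in_set(2)[OF assms(2,3), of F \<eta>0] by (auto simp: pf_ne_eg_upto_def)
next
  case (Suc t)
  then have IH: "z (Suc t) \<in> Z" "0 < \<eta> t" "\<eta> t \<le> \<eta>0" by auto
  have "line_search Z F \<theta> \<rho> (z (Suc t)) (\<eta> t) (Accept (\<eta> (Suc t)))"
    and "z (Suc (Suc t)) = eg_next Z F (z (Suc t)) (\<eta> (Suc t))"
    using assms(1) Suc.prems by (auto simp: pf_ne_eg_upto_def)
  then show ?case
    using line_search_AcceptD[OF _ assms(5,6) IH(2)] IH eg_in_set(2)[OF assms(2) IH(1)] by force
qed

lemma pf_ne_eg_residual:
  fixes Z :: "(real ^ 'n) set"
  assumes Z: "closed Z" "convex Z" and mon: "monotone_operator_on Z F"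
    and F: "locally_lipschitz_on Z F" and sol: "vi_solution Z F u"
    and "z0 \<in> Z" "\<eta>0 > 0" and \<theta>: "0 < \<theta>" "\<theta> < 1" and \<rho>: "0 < \<rho>" "\<rho> < 1"
    and run: "pf_ne_eg_forever Z F \<theta> \<rho> z0 \<eta>0 z w \<eta>"
    and \<xi>: "\<And>t. \<xi> (Suc t) = - (1 / \<eta> t) *\<^sub>R (z (Suc t) - (z t - \<eta> t *\<^sub>R F (w t)))"
  shows "(\<lambda>T. norm (F (z T) + \<xi> T)) \<in> o(\<lambda>T. 1 / sqrt (real T))"
proof -
  have upto: "pf_ne_eg_upto Z F \<theta> \<rho> z0 \<eta>0 T z w \<eta>" for T
    using run by (simp add: pf_ne_eg_forever_def)
  have zZ: "z t \<in> Z" and \<eta>: "0 < \<eta> t" "\<eta> t \<le> \<eta>0" for t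
    using pf_ne_eg_upto_invariant[OF upto Z(1) \<open>z0 \<in> Z\<close> \<open>\<eta>0 > 0\<close> \<rho>, of t t] by auto
  have w: "w t = eg_mid Z F (z t) (\<eta> t)" and z': "z (Suc t) = eg_next Z F (z t) (\<eta> t)" for t
    using upto[of t] by (auto simp: pf_ne_eg_upto_def)
  have ls: "line_search Z F \<theta> \<rho> (z (Suc t)) (\<eta> t) (Accept (\<eta> (Suc t)))" for t
    using upto[of "Suc t"] by (auto simp: pf_ne_eg_upto_def)
  \<comment> \<open>The initial stepsize is never tested, so both inequalities are available from
    iteration 1 on only.\<close>
  have ok: "step_ok Z F \<theta> (z (Suc t)) (\<eta> (Suc t))"
    "eg_mid Z F (z (Suc t)) (\<eta> (Suc t)) \<noteq> z (Suc t)" for t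
    using line_search_AcceptD[OF ls \<rho> \<eta>(1)] by auto
  note lip = step_okD[OF ok, folded w z']

  let ?d = "\<lambda>t. (norm (z (Suc t) - w (Suc t)))\<^sup>2 + (norm (w (Suc t) - z (Suc (Suc t))))\<^sup>2"
  let ?V = "\<lambda>t. (norm (z (Suc t) - u))\<^sup>2"
  have desc: "(1 - \<theta>) * ?d t \<le> ?V t - ?V (Suc t)" for t
    using eg_descent[OF Z mon zZ \<eta>(1) sol w z' lip(1)] \<theta> by simp
  have "decseq ?V"
  proof (rule decseq_SucI)
    fix t show "?V (Suc t) \<le> ?V t"
      using desc[of t] \<theta> mult_nonneg_nonneg[of "1 - \<theta>" "?d t"]
        zero_le_power2[of "norm (z (Suc t) - w (Suc t))"]
        zero_le_power2[of "norm (w (Suc t) - z (Suc (Suc t)))"] by linarith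
  qed
  then have bound: "norm (z (Suc t)) \<le> norm (z 1 - u) + norm u" for t
  proof -
    have "?V t \<le> ?V 0" using \<open>decseq ?V\<close> by (simp add: decseq_def)
    then have "norm (z (Suc t) - u) \<le> norm (z 1 - u)" by simp
    then show ?thesis using norm_triangle_sub[of "z (Suc t)" u] by simp
  qed
  have sumd: "summable ?d"
  proof (rule summableI_nonneg_bounded)
    fix n
    have "(1 - \<theta>) * (\<Sum>t<n. ?d t) \<le> (\<Sum>t<n. ?V t - ?V (Suc t))"
      unfolding sum_distrib_left by (intro sum_mono desc)
    also have "\<dots> \<le> ?V 0" by (subst sum_lessThan_telescope') simp
    finally show "(\<Sum>t<n. ?d t) \<le> ?V 0 / (1 - \<theta>)"
      using \<theta> by (simp add: field_simps)
  qed simp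

  obtain c where c: "0 < c"
    and okc: "\<And>p s. p \<in> Z \<Longrightarrow> norm p \<le> norm (z 1 - u) + norm u \<Longrightarrow> 0 < s \<Longrightarrow> s \<le> \<eta>0
      \<Longrightarrow> s \<le> c \<Longrightarrow> step_ok Z F \<theta> p s"
    using step_ok_uniform[OF Z F \<theta>, of "norm (z 1 - u) + norm u" \<eta>0] by metis
  \<comment> \<open>The \<open>\<eta>0\<close> covers runs in which no trial is ever rejected;
    otherwise \<open>\<rho> * c\<close> is the floor.\<close>
  define m where "m = min \<eta>0 (\<rho> * c)"
  have "0 < m" using c \<rho> \<open>\<eta>0 > 0\<close> by (simp add: m_def)
  have m: "m \<le> \<eta> t" for t
  proof (induction t)
    case 0
    then show ?case using upto[of 0] by (simp add: m_def pf_ne_eg_upto_def)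
  next
    case (Suc t)
    have "min (\<eta> t) (\<rho> * c) \<le> \<eta> (Suc t)"
      using \<eta>(2)[of t] by (intro line_search_Accept_ge[OF ls \<rho> \<eta>(1) c] okc zZ bound) auto
    then show ?case using Suc by (simp add: m_def)
  qed

  let ?r = "\<lambda>T. norm (F (z T) + \<xi> T)"
  \<comment> \<open>This needs only the projection, not the tests, so it holds at \<open>z 1\<close>
    too and the monotone decrease can start there.\<close>
  have normal: "\<xi> (Suc t) \<bullet> (p - z (Suc t)) \<le> 0" if "p \<in> Z" for t p
  proof -
    have "z t - \<eta> t *\<^sub>R F (w t) - z (Suc t) = \<eta> t *\<^sub>R \<xi> (Suc t)"
      using \<eta>(1)[of t] by (simp add: \<xi> algebra_simps)
    moreover have "closest_point Z (z t - \<eta> t *\<^sub>R F (w t)) = z (Suc t)"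
      by (simp add: z' eg_next_def w)
    ultimately have "(\<eta> t *\<^sub>R \<xi> (Suc t)) \<bullet> (p - z (Suc t)) \<le> 0"
      using closest_point_normal[OF Z(2,1) that] by metis
    then show ?thesis using \<eta>(1)[of t] by (simp add: mult_le_0_iff)
  qed
  have mono: "?r (Suc (Suc t)) \<le> ?r (Suc t)" for t
    by (rule residual_nonincreasing[OF Z mon zZ \<eta>(1) w z' lip(2) normal \<xi>])
  have le: "(?r (Suc (Suc t)))\<^sup>2 \<le> 8 / m\<^sup>2 * ?d t" for t
  proof -
    have "(?r (Suc (Suc t)))\<^sup>2 \<le> 8 / (\<eta> (Suc t))\<^sup>2 * ?d t"
      by (rule residual_le[OF \<eta>(1) lip(2) \<xi>])
    also have "\<dots> \<le> 8 / m\<^sup>2 * ?d t"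
      using m[of "Suc t"] \<open>0 < m\<close>
      by (intro mult_right_mono divide_left_mono power_mono) auto
    finally show ?thesis .
  qed
  have "summable (\<lambda>t. (?r (Suc (Suc t)))\<^sup>2)"
    by (rule summable_comparison_test'[OF summable_mult[OF sumd, of "8 / m\<^sup>2"], of 0])
      (use le in auto)
  \<comment> \<open>The bound \<open>le\<close> starts at the residual with index 2; one further
    term does not affect summability.\<close>
  then have "summable (\<lambda>t. (?r (Suc t))\<^sup>2)"
    by (subst summable_Suc_iff[symmetric])
  then show ?thesis using mono by (intro smallo_inverse_sqrt) auto
qed

theorem mainTheorem3:
  fixes Z :: "(real ^ 'n) set" and F :: "real ^ 'n \<Rightarrow> real ^ 'n"
    and z0 :: "real ^ 'n" and \<eta>0 \<theta> \<rho> :: real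
  assumes "Z \<noteq> {}" and "closed Z" and "convex Z"
    and "monotone_operator_on Z F"
    and "locally_lipschitz_on Z F"
    and "\<exists>zs. vi_solution Z F zs"
    and "z0 \<in> Z" and "\<eta>0 > 0"
    and "0 < \<theta>" and "\<theta> < 1"
    and "0 < \<rho>" and "\<rho> < 1"
  shows "(\<forall>T z w \<eta>. pf_ne_eg_upto Z F \<theta> \<rho> z0 \<eta>0 T z w \<eta> \<longrightarrow>
            (\<exists>r. line_search Z F \<theta> \<rho> (z (Suc T)) (\<eta> T) r) \<and>
            (\<forall>\<eta>'. line_search Z F \<theta> \<rho> (z (Suc T)) (\<eta> T) (Accept \<eta>') \<longrightarrow> \<eta>' > 0))
       \<and> (\<forall>z w \<eta> \<xi>. pf_ne_eg_forever Z F \<theta> \<rho> z0 \<eta>0 z w \<eta> \<longrightarrow>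
            (\<forall>t. \<xi> (Suc t) = - (1 / \<eta> t) *\<^sub>R (z (Suc t) - (z t - \<eta> t *\<^sub>R F (w t)))) \<longrightarrow>
            (\<lambda>T. norm (F (z T) + \<xi> T)) \<in> o(\<lambda>T. 1 / sqrt (real T)))"
proof (intro conjI allI impI)
  fix T z w \<eta> assume run: "pf_ne_eg_upto Z F \<theta> \<rho> z0 \<eta>0 T z w \<eta>"
  have zT: "z (Suc T) \<in> Z" and \<eta>T: "0 < \<eta> T"
    using pf_ne_eg_upto_invariant[OF run assms(2,7,8,11,12), of T] by auto
  \<comment> \<open>Termination concerns a single iterate, so its own norm serves as the radius and
    \<open>\<eta> T\<close> as the cap on the stepsize.\<close>
  obtain c where "0 < c" "\<And>s. 0 < s \<Longrightarrow> s \<le> \<eta> T \<Longrightarrow> s \<le> c \<Longrightarrow> step_ok Z F \<theta> (z (Suc T)) s"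
    using step_ok_uniform[OF assms(2,3,5,9,10), of "norm (z (Suc T))" "\<eta> T"] zT by (metis order_refl)
  then show "\<exists>r. line_search Z F \<theta> \<rho> (z (Suc T)) (\<eta> T) r"
    using line_search_terminates[OF assms(11,12) \<eta>T] by blast
  show "\<eta>' > 0" if "line_search Z F \<theta> \<rho> (z (Suc T)) (\<eta> T) (Accept \<eta>')" for \<eta>'
    using line_search_AcceptD[OF that assms(11,12) \<eta>T] by simp
next
  fix z w \<eta> \<xi>
  assume run: "pf_ne_eg_forever Z F \<theta> \<rho> z0 \<eta>0 z w \<eta>"
    and \<xi>: "\<forall>t. \<xi> (Suc t) = - (1 / \<eta> t) *\<^sub>R (z (Suc t) - (z t - \<eta> t *\<^sub>R F (w t)))"
  obtain u where "vi_solution Z F u" using assms(6) by blast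
  then show "(\<lambda>T. norm (F (z T) + \<xi> T)) \<in> o(\<lambda>T. 1 / sqrt (real T))"
    using pf_ne_eg_residual[OF assms(2-5) _ assms(7-12) run] \<xi> by blast
qed

end
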